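(* Let $V$ be an elliptical random element of a separable Hilbert space $\mathcal{H}$ with mean $\mu$ and covariance operator $\Gamma$ with finite trace. Let $\phi_1\in\mathcal{H}$ be an eigenfunction of $\Gamma$ with norm $1$, related to its largest eigenvalue $\lambda_1$. Assume that for every $v\in\mathcal{H}$ the real random variable $Y=\langle v,V-\mu\rangle$ has two principal points, and let $\gamma_1,\gamma_2\in\mathbb{R}$ be two principal points of the real random variable $\langle\phi_1,V-\mu\rangle$. Then $V$ has two principal points, namely $y_1=\mu+\gamma_1\phi_1$ and $y_2=\mu+\gamma_2\phi_1$ (that is, $\{y_1,y_2\}$ is a set of $k=2$ principal points of $V$).
   Context: All Hilbert spaces are real. Multivariate elliptical distribution: a random vector $X\in\mathbb{R}^d$ is elliptical, $X\sim\mathcal{E}_d(\mu,\Sigma)$, if there are $\mu\in\mathbb{R}^d$, a positive semidefinite $\Sigma\in\mathbb{R}^{d\times d}$ and a function $\phi:\mathbb{R}_+\to\mathbb{R}$ such that the characteristic function of $X-\mu$ is $t\mapsto\phi(t^{T}\Sigma t)$, $t\in\mathbb{R}^d$. Elliptical random element: a random element $V$ of a separable Hilbert space $\mathcal{H}$ is elliptical with parameters $\mu\in\mathcal{H}$ and $\Gamma:\mathcal{H}\to\mathcal{H}$ (self-adjoint, positive semidefinite, compact), written $V\sim\mathcal{E}(\mu,\Gamma)$, if for every $d$ and every bounded linear operator $A:\mathcal{H}\to\mathbb{R}^d$ one has $AV\sim\mathcal{E}_d(A\mu,A\Gamma A^* )$, where $A^*$ is the adjoint of $A$. $V$ is called elliptical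 if this holds for some $\mu,\Gamma$. Covariance operator: it is the operator $\Gamma$ with $\langle\Gamma u,v\rangle=\mathrm{Cov}(\langle u,V\rangle,\langle v,V\rangle)$ for $u,v\in\mathcal{H}$; its existence presupposes $E(\|V\|^2)<\infty$. Principal points: for a separable Hilbert space $\mathcal{K}$ (including $\mathcal{K}=\mathbb{R}$), a random element $Z$ of $\mathcal{K}$ with $E(\|Z\|^2)<\infty$ and $y_1,\ldots,y_k\in\mathcal{K}$, put $d(Z,\{y_1,\ldots,y_k\})=\min_{1\le j\le k}\|Z-y_j\|$. Elements $\xi_1,\ldots,\xi_k\in\mathcal{K}$ are called ($k$) principal points of $Z$ if $E(d^2(Z,\{\xi_1,\ldots,\xi_k\}))=\min_{y_1,\ldots,y_k\in\mathcal{K}}E(d^2(Z,\{y_1,\ldots,y_k\}))$. *)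

theory Defs
  imports "HOL-Probability.Probability"
begin

text \<open>
  Vectors of \<open>\<real>\<^sup>d\<close> are functions on \<^typ>\<open>nat\<close> of which only the coordinates \<open>i < d\<close> matter
  (and \<open>d \<times> d\<close> matrices likewise), because \<open>d\<close> has to be quantified over in the definition of an
  elliptical random element.
\<close>

definition psd_matrix :: "nat \<Rightarrow> (nat \<Rightarrow> nat \<Rightarrow> real) \<Rightarrow> bool" where
  "psd_matrix d S \<longleftrightarrow>
     (\<forall>i<d. \<forall>j<d. S i j = S j i) \<and>
     (\<forall>t :: nat \<Rightarrow> real. 0 \<le> (\<Sum>i<d. \<Sum>j<d. t i * S i j * t j))"

text \<open>
  By positive semidefiniteness \<open>\<phi>\<close> below is only evaluated on the nonnegative reals.
\<close>

definition elliptical_vector ::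
  "'w measure \<Rightarrow> nat \<Rightarrow> ('w \<Rightarrow> nat \<Rightarrow> real) \<Rightarrow> (nat \<Rightarrow> real) \<Rightarrow> (nat \<Rightarrow> nat \<Rightarrow> real) \<Rightarrow> bool" where
  "elliptical_vector M d X m S \<longleftrightarrow>
     (\<forall>i<d. (\<lambda>\<omega>. X \<omega> i) \<in> borel_measurable M) \<and>
     psd_matrix d S \<and>
     (\<exists>\<phi> :: real \<Rightarrow> real. \<forall>t :: nat \<Rightarrow> real.
        (CLINT \<omega>|M. iexp (\<Sum>i<d. t i * (X \<omega> i - m i))) =
        complex_of_real (\<phi> (\<Sum>i<d. \<Sum>j<d. t i * S i j * t j)))"

text \<open>
  A linear map into \<open>\<real>\<^sup>d\<close> is bounded iff all of its coordinate functionals are.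
\<close>

definition bounded_linear_vec :: "nat \<Rightarrow> ('h::real_normed_vector \<Rightarrow> nat \<Rightarrow> real) \<Rightarrow> bool" where
  "bounded_linear_vec d A \<longleftrightarrow> (\<forall>i<d. bounded_linear (\<lambda>h. A h i))"

text \<open>
  The Hilbert space adjoint of \<open>A : H \<rightarrow> \<real>\<^sup>d\<close>; compare \<^const>\<open>adjoint\<close>, which does not
  apply since \<open>\<real>\<^sup>d\<close> is not a type here.
\<close>

definition adjoint_vec :: "nat \<Rightarrow> ('h::real_inner \<Rightarrow> nat \<Rightarrow> real) \<Rightarrow> (nat \<Rightarrow> real) \<Rightarrow> 'h" where
  "adjoint_vec d A t = (THE w. \<forall>h. (\<Sum>i<d. A h i * t i) = h \<bullet> w)"

text \<open>
  The \<open>d \<times> d\<close> matrix of \<open>A \<Gamma> A\<^sup>*\<close>: its \<open>j\<close>-th column is the image of the \<open>j\<close>-th unit vector.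
\<close>

definition conj_matrix ::
  "nat \<Rightarrow> ('h::real_inner \<Rightarrow> nat \<Rightarrow> real) \<Rightarrow> ('h \<Rightarrow> 'h) \<Rightarrow> nat \<Rightarrow> nat \<Rightarrow> real" where
  "conj_matrix d A \<Gamma> i j = A (\<Gamma> (adjoint_vec d A (\<lambda>k. if k = j then 1 else 0))) i"

definition self_adjoint :: "('h::real_inner \<Rightarrow> 'h) \<Rightarrow> bool" where
  "self_adjoint \<Gamma> \<longleftrightarrow> (\<forall>u v. \<Gamma> u \<bullet> v = u \<bullet> \<Gamma> v)"

definition psd_operator :: "('h::real_inner \<Rightarrow> 'h) \<Rightarrow> bool" where
  "psd_operator \<Gamma> \<longleftrightarrow> (\<forall>u. 0 \<le> \<Gamma> u \<bullet> u)"

definition compact_operator :: "('h::real_normed_vector \<Rightarrow> 'h) \<Rightarrow> bool" where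
  "compact_operator \<Gamma> \<longleftrightarrow>
     bounded_linear \<Gamma> \<and> (\<forall>S. bounded S \<longrightarrow> compact (closure (\<Gamma> ` S)))"

definition elliptical_with ::
  "'w measure \<Rightarrow> ('w \<Rightarrow> 'h::{real_inner, banach, second_countable_topology}) \<Rightarrow>
     'h \<Rightarrow> ('h \<Rightarrow> 'h) \<Rightarrow> bool" where
  "elliptical_with M V \<mu> \<Gamma> \<longleftrightarrow>
     V \<in> borel_measurable M \<and>
     self_adjoint \<Gamma> \<and> psd_operator \<Gamma> \<and> compact_operator \<Gamma> \<and>
     (\<forall>d A. bounded_linear_vec d A \<longrightarrow>
        elliptical_vector M d (\<lambda>\<omega>. A (V \<omega>)) (A \<mu>) (conj_matrix d A \<Gamma>))"

definition elliptical ::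
  "'w measure \<Rightarrow> ('w \<Rightarrow> 'h::{real_inner, banach, second_countable_topology}) \<Rightarrow> bool" where
  "elliptical M V \<longleftrightarrow> (\<exists>\<mu> \<Gamma>. elliptical_with M V \<mu> \<Gamma>)"

definition covariance :: "'w measure \<Rightarrow> ('w \<Rightarrow> real) \<Rightarrow> ('w \<Rightarrow> real) \<Rightarrow> real" where
  "covariance M X Y =
     (LINT \<omega>|M. (X \<omega> - (LINT \<eta>|M. X \<eta>)) * (Y \<omega> - (LINT \<eta>|M. Y \<eta>)))"

definition covariance_operator ::
  "'w measure \<Rightarrow> ('w \<Rightarrow> 'h::{real_inner, banach, second_countable_topology}) \<Rightarrow>
     ('h \<Rightarrow> 'h) \<Rightarrow> bool" where
  "covariance_operator M V \<Gamma> \<longleftrightarrow>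
     V \<in> borel_measurable M \<and> integrable M (\<lambda>\<omega>. (norm (V \<omega>))\<^sup>2) \<and>
     bounded_linear \<Gamma> \<and>
     (\<forall>u v. \<Gamma> u \<bullet> v = covariance M (\<lambda>\<omega>. u \<bullet> V \<omega>) (\<lambda>\<omega>. v \<bullet> V \<omega>))"

definition orthonormal_basis :: "'h::real_inner set \<Rightarrow> bool" where
  "orthonormal_basis B \<longleftrightarrow>
     pairwise orthogonal B \<and> (\<forall>e\<in>B. norm e = 1) \<and> closure (span B) = UNIV"

text \<open>
  For a positive semidefinite operator (such as a covariance operator) the trace does not depend
  on the orthonormal basis.
\<close>

definition finite_trace :: "('h::real_inner \<Rightarrow> 'h) \<Rightarrow> bool" where
  "finite_trace \<Gamma> \<longleftrightarrow> (\<exists>B. orthonormal_basis B \<and> (\<lambda>e. \<Gamma> e \<bullet> e) summable_on B)"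

definition eigenvalue_of :: "('h::real_vector \<Rightarrow> 'h) \<Rightarrow> real \<Rightarrow> bool" where
  "eigenvalue_of \<Gamma> l \<longleftrightarrow> (\<exists>v. v \<noteq> 0 \<and> \<Gamma> v = l *\<^sub>R v)"

definition largest_eigenvalue :: "('h::real_vector \<Rightarrow> 'h) \<Rightarrow> real \<Rightarrow> bool" where
  "largest_eigenvalue \<Gamma> l \<longleftrightarrow> eigenvalue_of \<Gamma> l \<and> (\<forall>l'. eigenvalue_of \<Gamma> l' \<longrightarrow> l' \<le> l)"

definition dist_points :: "'a::real_normed_vector \<Rightarrow> 'a list \<Rightarrow> real" where
  "dist_points z ys = Min ((\<lambda>y. norm (z - y)) ` set ys)"

text \<open>
  The \<open>k\<close> points are given as a list of length \<open>k\<close>; they are not required to be distinct.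
\<close>

definition principal_points ::
  "'w measure \<Rightarrow> ('w \<Rightarrow> 'a::{real_inner, banach, second_countable_topology}) \<Rightarrow> 'a list \<Rightarrow> bool" where
  "principal_points M Z \<xi>s \<longleftrightarrow>
     Z \<in> borel_measurable M \<and> integrable M (\<lambda>\<omega>. (norm (Z \<omega>))\<^sup>2) \<and> \<xi>s \<noteq> [] \<and>
     (\<forall>ys. length ys = length \<xi>s \<longrightarrow>
        (LINT \<omega>|M. (dist_points (Z \<omega>) \<xi>s)\<^sup>2) \<le> (LINT \<omega>|M. (dist_points (Z \<omega>) ys)\<^sup>2))"

end

theory Submission
  imports Defs
begin

text \<open>
  Split the squared distance to two points \<open>y\<^sub>1, y\<^sub>2\<close> along a unit direction \<open>v\<close> of the line through
  them: the expected loss is the one-dimensional loss of \<open>\<langle>v, V - \<mu>\<rangle>\<close> minus its variance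
  \<open>\<langle>\<Gamma> v, v\<rangle>\<close>, up to a constant that is smallest when the line passes through \<open>\<mu>\<close>. By ellipticity
  \<open>\<langle>v, V - \<mu>\<rangle>\<close> is distributed like \<open>c \<langle>\<phi>\<^sub>1, V - \<mu>\<rangle>\<close> (if \<open>\<lambda>\<^sub>1 > 0\<close>) with
  \<open>c\<^sup>2 = \<langle>\<Gamma> v, v\<rangle> / \<lambda>\<^sub>1 \<le> 1\<close>. The optimal loss of a multiple scales by \<open>c\<^sup>2\<close> and is at most the variance, hence the loss minus the variance is
  smallest for \<open>c = 1\<close>.
\<close>

section \<open>Squared distances to two points\<close>

lemma dist_points_pair_sq:
  fixes z :: "'a::real_normed_vector"
  shows "(dist_points z [x, y])\<^sup>2 = min ((norm (z - x))\<^sup>2) ((norm (z - y))\<^sup>2)"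
  by (simp add: dist_points_def min_def abs_le_square_iff [symmetric])

lemma dist_points_pair_sq_real:
  fixes z :: real
  shows "(dist_points z [x, y])\<^sup>2 = min ((z - x)\<^sup>2) ((z - y)\<^sup>2)"
  by (simp add: dist_points_pair_sq)

lemma dist_points_pair_sq_scale:
  fixes z c :: real
  assumes "c \<noteq> 0"
  shows "(dist_points (c * z) [x, y])\<^sup>2 = c\<^sup>2 * (dist_points z [x / c, y / c])\<^sup>2"
proof -
  have "(c * z - a)\<^sup>2 = c\<^sup>2 * (z - a / c)\<^sup>2" for a
    using assms by (simp add: power_mult_distrib [symmetric] right_diff_distrib)
  moreover have "min (c\<^sup>2 * r) (c\<^sup>2 * s) = c\<^sup>2 * min r s" for r s :: real
    using assms by (auto simp: min_def)
  ultimately show ?thesis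
    by (simp add: dist_points_pair_sq_real)
qed

text \<open>By Pythagoras, \<open>z\<close> has the same squared distance from the line
  \<open>p + t *\<^sub>R v\<close> whichever of the two points is considered. This part leaves the
  minimum, and what remains inside is one-dimensional.\<close>

lemma dist_points_pair_sq_line:
  fixes z p v :: "'a::real_inner"
  assumes "norm v = 1" "p \<bullet> v = 0"
  shows "(dist_points z [p + a *\<^sub>R v, p + b *\<^sub>R v])\<^sup>2 =
    (dist_points (v \<bullet> z) [a, b])\<^sup>2 - (v \<bullet> z)\<^sup>2 + (norm z)\<^sup>2 - 2 * (p \<bullet> z) + (norm p)\<^sup>2"
proof -
  have "v \<bullet> v = 1"
    using assms(1) by (simp add: norm_eq_1)
  then have "(norm (z - (p + t *\<^sub>R v)))\<^sup>2 =
      (v \<bullet> z - t)\<^sup>2 - (v \<bullet> z)\<^sup>2 + (norm z)\<^sup>2 - 2 * (p \<bullet> z) + (norm p)\<^sup>2" for t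
    using assms(2) unfolding power2_norm_eq_inner
    by (simp add: inner_commute algebra_simps power2_eq_square)
  then show ?thesis
    by (simp add: dist_points_pair_sq dist_points_pair_sq_real)
qed

text \<open>Brings an arbitrary pair of points into the form of the preceding lemma. Coinciding
  points determine no direction, so the given unit vector \<open>e\<close> takes its place;
  \<open>p\<close> is the foot of the perpendicular from the origin.\<close>

lemma exists_unit_line:
  fixes e y z :: "'a::real_inner"
  assumes "norm e = 1"
  obtains v p a b where "norm v = 1" "p \<bullet> v = 0" "y = p + a *\<^sub>R v" "z = p + b *\<^sub>R v"
proof -
  obtain v r where v: "norm v = 1" "y - z = r *\<^sub>R v"
  proof (cases "y = z")
    case True
    then show ?thesis using assms that [of e 0] by simp
  next
    case False
    then show ?thesis using that [of "sgn (y - z)" "norm (y - z)"]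
      by (simp add: norm_sgn sgn_div_norm)
  qed
  have "(y - (y \<bullet> v) *\<^sub>R v) \<bullet> v = 0"
    using v(1) by (simp add: inner_diff_left norm_eq_1)
  moreover have "z = (y - (y \<bullet> v) *\<^sub>R v) + (y \<bullet> v - r) *\<^sub>R v"
    using v(2) by (simp add: algebra_simps)
  ultimately show ?thesis
    using that [of v "y - (y \<bullet> v) *\<^sub>R v" "y \<bullet> v" "y \<bullet> v - r"] v(1) by simp
qed

lemma principal_points_pair_le:
  assumes "principal_points M Z [x, y]"
  shows "(LINT \<omega>|M. (dist_points (Z \<omega>) [x, y])\<^sup>2) \<le> (LINT \<omega>|M. (dist_points (Z \<omega>) [a, b])\<^sup>2)"
  using assms by (simp add: principal_points_def)

lemma integrable_norm_diff_sq:
  fixes X :: "'w \<Rightarrow> 'h::{real_inner, banach, second_countable_topology}"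
  assumes "finite_measure M" "X \<in> borel_measurable M" "integrable M (\<lambda>\<omega>. (norm (X \<omega>))\<^sup>2)"
  shows "integrable M (\<lambda>\<omega>. (norm (X \<omega> - y))\<^sup>2)"
proof (rule Bochner_Integration.integrable_bound)
  interpret finite_measure M by fact
  show "integrable M (\<lambda>\<omega>. 2 * (norm (X \<omega>))\<^sup>2 + 2 * (norm y)\<^sup>2)"
    using assms(3) by simp
  \<comment> \<open>Parallelogram law with the term for \<open>X \<omega> + y\<close>
    dropped.\<close>
  have "(norm (X \<omega> - y))\<^sup>2 \<le> 2 * (norm (X \<omega>))\<^sup>2 + 2 * (norm y)\<^sup>2" for \<omega>
    using zero_le_power2 [of "norm (X \<omega> + y)"]
    by (simp only: power2_norm_eq_inner) (simp add: inner_commute algebra_simps)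
  then show "AE \<omega> in M. norm ((norm (X \<omega> - y))\<^sup>2) \<le> norm (2 * (norm (X \<omega>))\<^sup>2 + 2 * (norm y)\<^sup>2)"
    by simp
qed (use assms in measurable)

lemma integrable_dist_points_pair_sq:
  fixes X :: "'w \<Rightarrow> 'h::{real_inner, banach, second_countable_topology}"
  assumes "finite_measure M" "X \<in> borel_measurable M" "integrable M (\<lambda>\<omega>. (norm (X \<omega>))\<^sup>2)"
  shows "integrable M (\<lambda>\<omega>. (dist_points (X \<omega>) [x, y])\<^sup>2)"
  unfolding dist_points_pair_sq
  by (intro integrable_min integrable_norm_diff_sq assms)

section \<open>Quadratic forms of positive semidefinite operators\<close>

text \<open>The form of \<open>T\<close> at \<open>u + t *\<^sub>R v\<close> is a polynomial in
  \<open>t\<close> of degree at most two that is never negative. The form may be degenerate, so a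
  vanishing leading coefficient is a separate case.\<close>

lemma psd_form_Cauchy_Schwarz:
  fixes T :: "'h::real_inner \<Rightarrow> 'h"
  assumes "linear T" "self_adjoint T" "psd_operator T"
  shows "(T u \<bullet> v)\<^sup>2 \<le> (T u \<bullet> u) * (T v \<bullet> v)"
proof -
  have sym: "T v \<bullet> u = T u \<bullet> v"
    using assms(2) by (metis inner_commute self_adjoint_def)
  have *: "0 \<le> (T u \<bullet> u) + 2 * t * (T u \<bullet> v) + t\<^sup>2 * (T v \<bullet> v)" for t
  proof -
    have "T (u + t *\<^sub>R v) \<bullet> (u + t *\<^sub>R v) = (T u \<bullet> u) + 2 * t * (T u \<bullet> v) + t\<^sup>2 * (T v \<bullet> v)"
      using sym by (simp add: linear_add [OF assms(1)] linear_scale [OF assms(1)]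
          inner_simps power2_eq_square algebra_simps)
    then show ?thesis
      using assms(3) by (metis psd_operator_def)
  qed
  show ?thesis
  proof (cases "T v \<bullet> v = 0")
    case True
    have "T u \<bullet> v = 0"
    proof (rule ccontr)
      assume "T u \<bullet> v \<noteq> 0"
      then show False
        \<comment> \<open>The polynomial is affine here, and this \<open>t\<close> gives it the
          value -1.\<close>
        using * [of "- (T u \<bullet> u + 1) / (2 * (T u \<bullet> v))"] True by (simp add: field_simps)
    qed
    then show ?thesis using True by simp
  next
    case False
    then have pos: "0 < T v \<bullet> v"
      using assms(3) by (simp add: psd_operator_def order_less_le)
    then show ?thesis
      \<comment> \<open>The minimiser of the quadratic polynomial.\<close>
      using * [of "- (T u \<bullet> v) / (T v \<bullet> v)"]
      by (simp add: field_simps power2_eq_square)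
  qed
qed

lemma compact_operator_scale:
  fixes T :: "'h::real_normed_vector \<Rightarrow> 'h"
  assumes "compact_operator T"
  shows "compact_operator (\<lambda>x. s *\<^sub>R T x)"
  unfolding compact_operator_def
proof (intro conjI allI impI)
  have T: "bounded_linear T"
    using assms by (simp add: compact_operator_def)
  then show "bounded_linear (\<lambda>x. s *\<^sub>R T x)"
    by (rule bounded_linear_const_scaleR)
  fix S :: "'h set"
  assume "bounded S"
  \<comment> \<open>The scalar moves into the argument, so that compactness of \<open>T\<close>
    applies to the scaled set, which is again bounded.\<close>
  moreover have "(\<lambda>x. s *\<^sub>R T x) ` S = T ` ((*\<^sub>R) s ` S)"
    by (simp add: image_image linear_scale [OF bounded_linear.linear [OF T]])
  ultimately show "compact (closure ((\<lambda>x. s *\<^sub>R T x) ` S))"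
    using assms by (simp add: compact_operator_def bounded_scaling)
qed

text \<open>
  For \<open>L\<close> the supremum of the quadratic form, \<open>L - T\<close> is positive semidefinite, so Cauchy-Schwarz for
  its form makes \<open>(L - T) u\<^sub>n\<close> vanish along a maximising sequence; compactness turns \<open>u\<^sub>n\<close> into an
  eigenvector.
\<close>

lemma quadratic_form_le_largest_eigenvalue:
  fixes T :: "'h::real_inner \<Rightarrow> 'h"
  assumes comp: "compact_operator T" and sa: "self_adjoint T" and psd: "psd_operator T"
    and eig: "largest_eigenvalue T l" and u: "norm u = 1"
  shows "T u \<bullet> u \<le> l"
proof -
  have bl: "bounded_linear T"
    using comp by (simp add: compact_operator_def)
  interpret T: bounded_linear T by fact
  define Q where "Q = (\<lambda>w. T w \<bullet> w) ` sphere 0 1"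
  define L where "L = Sup Q"
  have Q_le: "T w \<bullet> w \<le> onorm T" if "norm w = 1" for w
  proof -
    have "T w \<bullet> w \<le> norm (T w) * norm w"
      by (rule norm_cauchy_schwarz)
    also have "\<dots> \<le> onorm T"
      using onorm [OF bl, of w] that by simp
    finally show ?thesis .
  qed
  have bdd: "bdd_above Q"
    unfolding Q_def by (rule bdd_aboveI [of _ "onorm T"]) (auto simp: Q_le)
  have L_ge: "T w \<bullet> w \<le> L" if "norm w = 1" for w
    unfolding L_def by (rule cSup_upper [OF _ bdd]) (use that in \<open>auto simp: Q_def\<close>)
  \<comment> \<open>The eigenvector argument divides by \<open>L\<close>. If
    \<open>L \<le> 0\<close>, it is enough that \<open>l\<close>, an eigenvalue of a positive
    semidefinite operator, is nonnegative.\<close>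
  have "L \<le> l"
  proof (cases "L \<le> 0")
    case True
    obtain e where e: "e \<noteq> 0" "T e = l *\<^sub>R e"
      using eig by (auto simp: largest_eigenvalue_def eigenvalue_of_def)
    then have "0 \<le> l * (e \<bullet> e)"
      using psd by (metis inner_scaleR_left psd_operator_def)
    then have "0 \<le> l"
      using e(1) by (metis inner_gt_zero_iff linorder_not_le zero_le_mult_iff)
    then show ?thesis using True by simp
  next
    case False
    define B where "B = (\<lambda>w. L *\<^sub>R w - T w)"
    have blB: "bounded_linear B"
      unfolding B_def
      by (intro bounded_linear_sub bounded_linear_scaleR_right bl)
    have "self_adjoint B"
      using sa by (simp add: self_adjoint_def B_def inner_simps)
    have B_psd: "psd_operator B"
      unfolding psd_operator_def
    proof
      fix w
      show "0 \<le> B w \<bullet> w"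
      proof (cases "w = 0")
        case False
        have "T (sgn w) \<bullet> sgn w \<le> L"
          by (rule L_ge) (simp add: norm_sgn False)
        then have "T w \<bullet> w \<le> L * (norm w)\<^sup>2"
          using False by (simp add: sgn_div_norm T.scaleR field_simps power2_eq_square)
        then show ?thesis
          by (simp add: B_def inner_diff_left power2_norm_eq_inner)
      qed (simp add: B_def)
    qed
    \<comment> \<open>Cauchy-Schwarz for the form of \<open>B\<close> at \<open>w\<close> and
      \<open>B w\<close>, divided by the squared norm of \<open>B w\<close>: where the form is
      small, so is \<open>B\<close>.\<close>
    have B_le: "(norm (B w))\<^sup>2 \<le> (B w \<bullet> w) * onorm B" for w
    proof (cases "B w = 0")
      case False
      have "((norm (B w))\<^sup>2)\<^sup>2 \<le> (B w \<bullet> w) * (B (B w) \<bullet> B w)"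
        using psd_form_Cauchy_Schwarz [OF bounded_linear.linear [OF blB] \<open>self_adjoint B\<close> B_psd,
            of w "B w"]
        by (simp add: power2_norm_eq_inner)
      also have "\<dots> \<le> (B w \<bullet> w) * (onorm B * (norm (B w))\<^sup>2)"
      proof (rule mult_left_mono)
        have "B (B w) \<bullet> B w \<le> norm (B (B w)) * norm (B w)"
          by (rule norm_cauchy_schwarz)
        also have "\<dots> \<le> onorm B * norm (B w) * norm (B w)"
          by (intro mult_right_mono onorm [OF blB]) simp
        finally show "B (B w) \<bullet> B w \<le> onorm B * (norm (B w))\<^sup>2"
          by (simp add: power2_eq_square mult.assoc)
        show "0 \<le> B w \<bullet> w"
          using B_psd by (simp add: psd_operator_def)
      qed
      finally have "(norm (B w))\<^sup>2 * (norm (B w))\<^sup>2 \<le> ((B w \<bullet> w) * onorm B) * (norm (B w))\<^sup>2"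
        by (simp only: power2_eq_square [of "(norm (B w))\<^sup>2"] mult.assoc)
      then show ?thesis
        by (rule mult_right_le_imp_le) (simp add: False)
    qed simp
    have "\<exists>w. norm w = 1 \<and> L - inverse (real (Suc n)) < T w \<bullet> w" for n
    proof -
      have "Q \<noteq> {}"
        using u by (auto simp: Q_def)
      moreover have "L - inverse (real (Suc n)) < Sup Q"
        by (simp add: L_def)
      ultimately obtain q where "q \<in> Q" "L - inverse (real (Suc n)) < q"
        by (meson less_cSupE)
      then show ?thesis
        by (auto simp: Q_def)
    qed
    then obtain w where w: "\<And>n. norm (w n) = 1"
        "\<And>n. L - inverse (real (Suc n)) < T (w n) \<bullet> w n"
      by metis
    have "(\<lambda>n. B (w n)) \<longlonglongrightarrow> 0"
    proof -
      have BwL: "B (w n) \<bullet> w n = L - T (w n) \<bullet> w n" for n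
        using w(1) [of n] by (simp add: B_def inner_diff_left norm_eq_1)
      have "(\<lambda>n. (norm (B (w n)))\<^sup>2) \<longlonglongrightarrow> 0"
      proof (rule tendsto_sandwich)
        show "\<forall>\<^sub>F n in sequentially. 0 \<le> (norm (B (w n)))\<^sup>2"
          by simp
        show "\<forall>\<^sub>F n in sequentially. (norm (B (w n)))\<^sup>2 \<le> inverse (real (Suc n)) * onorm B"
        proof (rule always_eventually, rule allI)
          fix n
          have "(norm (B (w n)))\<^sup>2 \<le> (B (w n) \<bullet> w n) * onorm B"
            by (rule B_le)
          also have "\<dots> \<le> inverse (real (Suc n)) * onorm B"
            using w(2) [of n] BwL [of n] by (intro mult_right_mono onorm_pos_le blB) auto
          finally show "(norm (B (w n)))\<^sup>2 \<le> inverse (real (Suc n)) * onorm B" .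
        qed
        show "(\<lambda>n. inverse (real (Suc n)) * onorm B) \<longlonglongrightarrow> 0"
          using LIMSEQ_inverse_real_of_nat by (rule tendsto_mult_left_zero)
      qed simp
      then have "(\<lambda>n. norm (B (w n))) \<longlonglongrightarrow> 0"
        by (simp add: tendsto_null_power)
      then show ?thesis
        by (rule tendsto_norm_zero_cancel)
    qed
    have "bounded (range w)"
      using w(1) by (auto simp: bounded_iff)
    then have "compact (closure (T ` range w))"
      using comp by (simp add: compact_operator_def)
    moreover have "\<forall>n. T (w n) \<in> closure (T ` range w)"
      by (meson closure_subset imageI rangeI subsetD)
    ultimately obtain x r where r: "strict_mono (r :: nat \<Rightarrow> nat)"
        and x: "((\<lambda>n. T (w n)) \<circ> r) \<longlonglongrightarrow> x"
      by (metis (no_types, lifting) compact_def)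
    \<comment> \<open>Since \<open>B w + T w = L *\<^sub>R w\<close>, convergence of
      \<open>B\<close> and \<open>T\<close> along the subsequence yields convergence of the vectors
      themselves.\<close>
    have "(\<lambda>n. inverse L *\<^sub>R (B (w (r n)) + T (w (r n)))) \<longlonglongrightarrow> inverse L *\<^sub>R (0 + x)"
      using x LIMSEQ_subseq_LIMSEQ [OF \<open>(\<lambda>n. B (w n)) \<longlonglongrightarrow> 0\<close> r]
      by (intro tendsto_intros) (simp_all add: o_def)
    then have lim: "(\<lambda>n. w (r n)) \<longlonglongrightarrow> inverse L *\<^sub>R x"
      using False by (simp add: B_def)
    define v where "v = inverse L *\<^sub>R x"
    \<comment> \<open>The limit keeps norm 1, so it is nonzero and qualifies as an
      eigenvector.\<close>
    have "(\<lambda>n. norm (w (r n))) \<longlonglongrightarrow> norm v"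
      using lim unfolding v_def by (rule tendsto_norm)
    then have "norm v = 1"
      by (simp add: w(1) LIMSEQ_const_iff)
    have "(\<lambda>n. T (w (r n))) \<longlonglongrightarrow> T v"
      using lim unfolding v_def by (rule T.tendsto)
    then have "T v = x"
      using x LIMSEQ_unique by (fastforce simp: o_def)
    then have "T v = L *\<^sub>R v"
      using False by (simp add: v_def)
    then have "eigenvalue_of T L"
      using \<open>norm v = 1\<close> by (force simp: eigenvalue_of_def)
    then show ?thesis
      using eig by (simp add: largest_eigenvalue_def)
  qed
  then show ?thesis
    using L_ge [OF u] by simp
qed

text \<open>Polarization: the form at \<open>u + v\<close> recovers the bilinear form, which
  determines the operator.\<close>

lemma self_adjoint_eqI:
  fixes S T :: "'h::real_inner \<Rightarrow> 'h"
  assumes "linear S" "linear T" "self_adjoint S" "self_adjoint T"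
    and eq: "\<And>u. S u \<bullet> u = T u \<bullet> u"
  shows "S = T"
proof
  fix u
  have "S u \<bullet> v = T u \<bullet> v" for v
  proof -
    have "S v \<bullet> u = S u \<bullet> v" "T v \<bullet> u = T u \<bullet> v"
      using assms(3,4) by (metis inner_commute self_adjoint_def)+
    then show ?thesis
      using eq [of "u + v"] eq [of u] eq [of v]
      by (simp add: linear_add [OF assms(1)] linear_add [OF assms(2)] inner_simps)
  qed
  then show "S u = T u"
    by (metis vector_eq_rdot)
qed

section \<open>One-dimensional marginals of an elliptical element\<close>

text \<open>The definition of ellipticity lets \<phi> depend on the operator \<open>A\<close>.
  Applying it once, to the map from \<open>h\<close> to the pair of \<open>u \<bullet> h\<close> and
  \<open>w \<bullet> h\<close>, gives one \<phi> for both directions, which two one-dimensional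
  applications would not.\<close>

lemma elliptical_char_pair:
  fixes V :: "'w \<Rightarrow> 'h::{real_inner, banach, second_countable_topology}"
  assumes "elliptical_with M V m G"
  obtains \<phi> :: "real \<Rightarrow> real" where
    "\<And>t. (CLINT \<omega>|M. iexp (t * (u \<bullet> (V \<omega> - m)))) = \<phi> (t\<^sup>2 * (u \<bullet> G u))"
    "\<And>t. (CLINT \<omega>|M. iexp (t * (w \<bullet> (V \<omega> - m)))) = \<phi> (t\<^sup>2 * (w \<bullet> G w))"
proof -
  define a :: "nat \<Rightarrow> 'h" where "a = (\<lambda>i. if i = 0 then u else w)"
  define A :: "'h \<Rightarrow> nat \<Rightarrow> real" where "A = (\<lambda>h i. a i \<bullet> h)"
  have "bounded_linear_vec 2 A"
    by (simp add: bounded_linear_vec_def A_def bounded_linear_inner_right)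
  then have ell: "elliptical_vector M 2 (\<lambda>\<omega>. A (V \<omega>)) (A m) (conj_matrix 2 A G)"
    using assms by (simp add: elliptical_with_def)
  \<comment> \<open>The definite description is resolved by exhibiting the adjoint; it is unique
    because inner products with all \<open>h\<close> determine a vector.\<close>
  have adj: "adjoint_vec 2 A t = (\<Sum>i<2. t i *\<^sub>R a i)" for t
    unfolding adjoint_vec_def
  proof (rule the_equality)
    show "\<forall>h. (\<Sum>i<2. A h i * t i) = h \<bullet> (\<Sum>i<2. t i *\<^sub>R a i)"
      by (simp add: A_def inner_sum_right inner_commute mult.commute)
    then show "x = (\<Sum>i<2. t i *\<^sub>R a i)" if "\<forall>h. (\<Sum>i<2. A h i * t i) = h \<bullet> x" for x
      using that by (metis vector_eq_ldot)
  qed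
  have conj: "conj_matrix 2 A G 0 0 = u \<bullet> G u"
      "conj_matrix 2 A G (Suc 0) (Suc 0) = w \<bullet> G w"
    unfolding conj_matrix_def adj by (simp_all add: numeral_2_eq_2 A_def a_def)
  obtain \<phi> :: "real \<Rightarrow> real" where \<phi>: "\<And>t :: nat \<Rightarrow> real.
      (CLINT \<omega>|M. iexp (\<Sum>i<2. t i * (A (V \<omega>) i - A m i))) =
      complex_of_real (\<phi> (\<Sum>i<2. \<Sum>j<2. t i * conj_matrix 2 A G i j * t j))"
    using ell unfolding elliptical_vector_def by blast
  show ?thesis
  proof (rule that [of \<phi>])
    fix t
    show "(CLINT \<omega>|M. iexp (t * (u \<bullet> (V \<omega> - m)))) = \<phi> (t\<^sup>2 * (u \<bullet> G u))"
      \<comment> \<open>A multiple of one unit vector picks out one diagonal entry of the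
        matrix.\<close>
      using \<phi> [of "\<lambda>i. if i = 0 then t else 0"] conj
      by (simp add: numeral_2_eq_2 A_def a_def inner_diff_right power2_eq_square mult_ac)
    show "(CLINT \<omega>|M. iexp (t * (w \<bullet> (V \<omega> - m)))) = \<phi> (t\<^sup>2 * (w \<bullet> G w))"
      using \<phi> [of "\<lambda>i. if i = 0 then 0 else t"] conj
      by (simp add: numeral_2_eq_2 A_def a_def inner_diff_right power2_eq_square mult_ac)
  qed
qed

text \<open>With a common \<phi>, the characteristic functions depend on the direction only through
  the form of \<open>G\<close>, and they determine the distribution.\<close>

lemma elliptical_distr_eq:
  fixes V :: "'w \<Rightarrow> 'h::{real_inner, banach, second_countable_topology}"
  assumes "prob_space M" and ell: "elliptical_with M V m G" and eq: "u \<bullet> G u = w \<bullet> G w"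
  shows "distr M borel (\<lambda>\<omega>. u \<bullet> (V \<omega> - m)) = distr M borel (\<lambda>\<omega>. w \<bullet> (V \<omega> - m))"
proof (rule Levy_uniqueness)
  interpret prob_space M by fact
  have [measurable]: "V \<in> borel_measurable M"
    using ell by (simp add: elliptical_with_def)
  have *: "real_distribution (distr M borel (\<lambda>\<omega>. x \<bullet> (V \<omega> - m)))" for x
    by (rule real_distribution_distr) measurable
  show "real_distribution (distr M borel (\<lambda>\<omega>. u \<bullet> (V \<omega> - m)))"
    "real_distribution (distr M borel (\<lambda>\<omega>. w \<bullet> (V \<omega> - m)))"
    by (rule *)+
  obtain \<phi> :: "real \<Rightarrow> real" where \<phi>:
    "\<And>t. (CLINT \<omega>|M. iexp (t * (u \<bullet> (V \<omega> - m)))) = \<phi> (t\<^sup>2 * (u \<bullet> G u))"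
    "\<And>t. (CLINT \<omega>|M. iexp (t * (w \<bullet> (V \<omega> - m)))) = \<phi> (t\<^sup>2 * (w \<bullet> G w))"
    using elliptical_char_pair [OF ell, of u w] by blast
  have "char (distr M borel (\<lambda>\<omega>. x \<bullet> (V \<omega> - m))) t = (CLINT \<omega>|M. iexp (t * (x \<bullet> (V \<omega> - m))))"
    for x t
    unfolding char_def by (subst integral_distr) simp_all
  then show "char (distr M borel (\<lambda>\<omega>. u \<bullet> (V \<omega> - m))) =
      char (distr M borel (\<lambda>\<omega>. w \<bullet> (V \<omega> - m)))"
    using \<phi> eq by (auto simp: fun_eq_iff)
qed

lemma elliptical_integral_eq:
  fixes V :: "'w \<Rightarrow> 'h::{real_inner, banach, second_countable_topology}" and f :: "real \<Rightarrow> real"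
  assumes "prob_space M" and ell: "elliptical_with M V m G" and eq: "u \<bullet> G u = w \<bullet> G w"
    and [measurable]: "f \<in> borel_measurable borel"
  shows "(LINT \<omega>|M. f (u \<bullet> (V \<omega> - m))) = (LINT \<omega>|M. f (w \<bullet> (V \<omega> - m)))"
proof -
  have [measurable]: "V \<in> borel_measurable M"
    using ell by (simp add: elliptical_with_def)
  have "(LINT \<omega>|M. f (x \<bullet> (V \<omega> - m))) = (LINT y|distr M borel (\<lambda>\<omega>. x \<bullet> (V \<omega> - m)). f y)" for x
    by (subst integral_distr) simp_all
  then show ?thesis
    using elliptical_distr_eq [OF assms(1-3)] by simp
qed

text \<open>The one-dimensional marginals are symmetric about \<open>m\<close>.\<close>

lemma elliptical_mean:
  fixes V :: "'w \<Rightarrow> 'h::{real_inner, banach, second_countable_topology}"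
  assumes "prob_space M" and ell: "elliptical_with M V m G" and int: "integrable M V"
  shows "(LINT \<omega>|M. V \<omega>) = m"
proof -
  interpret prob_space M by fact
  have "bounded_linear G"
    using ell by (simp add: elliptical_with_def compact_operator_def)
  then interpret G: bounded_linear G .
  have "u \<bullet> (LINT \<omega>|M. V \<omega>) = u \<bullet> m" for u
  proof -
    \<comment> \<open>The form of \<open>G\<close> has the same value at \<open>u\<close> and
      \<open>- u\<close>, so the expectation equals its own negative.\<close>
    have "(LINT \<omega>|M. u \<bullet> (V \<omega> - m)) = (LINT \<omega>|M. (- u) \<bullet> (V \<omega> - m))"
      using elliptical_integral_eq [OF assms(1) ell, of u "- u" "\<lambda>x. x"] by (simp add: linear_neg [OF G.linear_axioms])
    then have "(LINT \<omega>|M. u \<bullet> (V \<omega> - m)) = 0"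
      by simp
    then show ?thesis
      using int by (simp add: inner_diff_right prob_space)
  qed
  then show ?thesis
    by (metis vector_eq_ldot)
qed

section \<open>The covariance operator of an elliptical element\<close>

lemma covariance_operator_self_adjoint:
  assumes "covariance_operator M V \<Gamma>"
  shows "self_adjoint \<Gamma>"
proof -
  have "\<Gamma> u \<bullet> v = \<Gamma> v \<bullet> u" for u v
    using assms by (simp add: covariance_operator_def covariance_def mult.commute)
  then show ?thesis
    by (metis inner_commute self_adjoint_def)
qed

lemma covariance_operator_form:
  fixes V :: "'w \<Rightarrow> 'h::{real_inner, banach, second_countable_topology}"
  assumes "covariance_operator M V \<Gamma>" "integrable M V"
  shows "\<Gamma> u \<bullet> u = (LINT \<omega>|M. (u \<bullet> (V \<omega> - (LINT \<eta>|M. V \<eta>)))\<^sup>2)"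
  using assms by (simp add: covariance_operator_def covariance_def inner_diff_right power2_eq_square)

text \<open>The operator \<open>G\<close> from the definition of ellipticity need not be the
  covariance operator, as \<phi> can absorb a factor. The variance in direction \<open>u\<close> is
  a function of \<open>u \<bullet> G u\<close> alone, and both are quadratic in \<open>u\<close>, so
  they are proportional.\<close>

lemma elliptical_covariance_operator:
  fixes V :: "'w \<Rightarrow> 'h::{real_inner, banach, second_countable_topology}"
  assumes "prob_space M" and ell: "elliptical_with M V m G" and int: "integrable M V"
    and cov: "covariance_operator M V \<Gamma>"
  obtains s where "\<Gamma> = (\<lambda>x. s *\<^sub>R G x)"
proof -
  have bG: "bounded_linear G" and saG: "self_adjoint G" and psdG: "psd_operator G"
    using ell by (auto simp: elliptical_with_def compact_operator_def)
  interpret G: bounded_linear G by fact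
  have "bounded_linear \<Gamma>"
    using cov by (simp add: covariance_operator_def)
  then interpret \<Gamma>: bounded_linear \<Gamma> .
  have inv: "\<Gamma> u \<bullet> u = \<Gamma> w \<bullet> w" if "u \<bullet> G u = w \<bullet> G w" for u w
    using elliptical_integral_eq [OF assms(1) ell that, of "\<lambda>x. x\<^sup>2"]
    by (simp add: covariance_operator_form [OF cov int] elliptical_mean [OF assms(1) ell int])
  have "\<exists>s. \<forall>u. \<Gamma> u \<bullet> u = s * (u \<bullet> G u)"
  proof (cases "\<forall>u. u \<bullet> G u = 0")
    case True
    \<comment> \<open>Every direction has the same form value as the zero vector, hence variance
      0.\<close>
    then have "\<Gamma> u \<bullet> u = 0" for u
      using inv [of u 0] by simp
    then show ?thesis
      by (intro exI [of _ 0]) simp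
  next
    case False
    then obtain e where e: "0 < e \<bullet> G e"
      using psdG by (metis inner_commute order_less_le psd_operator_def)
    have "\<Gamma> u \<bullet> u = (\<Gamma> e \<bullet> e) / (e \<bullet> G e) * (u \<bullet> G u)" for u
    proof -
      \<comment> \<open>Chosen so that \<open>u\<close> and \<open>c *\<^sub>R e\<close> have the
        same form value under \<open>G\<close>.\<close>
      define c where "c = sqrt ((u \<bullet> G u) / (e \<bullet> G e))"
      have "0 \<le> u \<bullet> G u"
        using psdG by (metis inner_commute psd_operator_def)
      then have c: "c * c = (u \<bullet> G u) / (e \<bullet> G e)"
        using e by (simp add: c_def)
      have "u \<bullet> G u = (c *\<^sub>R e) \<bullet> G (c *\<^sub>R e)"
        using c e by (simp add: G.scaleR mult.assoc [symmetric])
      then have "\<Gamma> u \<bullet> u = \<Gamma> (c *\<^sub>R e) \<bullet> (c *\<^sub>R e)"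
        by (rule inv)
      then have "\<Gamma> u \<bullet> u = c * c * (\<Gamma> e \<bullet> e)"
        by (simp add: \<Gamma>.scaleR mult.assoc)
      then show ?thesis
        by (simp add: c)
    qed
    then show ?thesis by blast
  qed
  then obtain s where s: "\<And>u. \<Gamma> u \<bullet> u = s * (u \<bullet> G u)"
    by blast
  have "\<Gamma> = (\<lambda>x. s *\<^sub>R G x)"
  proof (rule self_adjoint_eqI)
    show "linear \<Gamma>"
      by (rule \<Gamma>.linear_axioms)
    show "linear (\<lambda>x. s *\<^sub>R G x)"
      by (intro bounded_linear.linear bounded_linear_const_scaleR bG)
    show "self_adjoint \<Gamma>"
      using cov by (rule covariance_operator_self_adjoint)
    show "self_adjoint (\<lambda>x. s *\<^sub>R G x)"
      using saG by (simp add: self_adjoint_def)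
    show "\<Gamma> u \<bullet> u = s *\<^sub>R G u \<bullet> u" for u
      using s [of u] by (simp add: inner_commute)
  qed
  then show ?thesis ..
qed

section \<open>Expected loss and its comparison between directions\<close>

text \<open>The cross term with \<open>p\<close> is linear in \<open>W\<close> and vanishes because
  \<open>W\<close> is centred. Thus the offset \<open>p\<close> of the line only adds its squared
  norm.\<close>

lemma integral_dist_points_pair_line:
  fixes W :: "'w \<Rightarrow> 'h::{real_inner, banach, second_countable_topology}"
  assumes "prob_space M" and W: "integrable M W" "(LINT \<omega>|M. W \<omega>) = 0"
    and sq: "integrable M (\<lambda>\<omega>. (norm (W \<omega>))\<^sup>2)"
    and v: "norm v = 1" "p \<bullet> v = 0"
  shows "(LINT \<omega>|M. (dist_points (W \<omega>) [p + a *\<^sub>R v, p + b *\<^sub>R v])\<^sup>2) =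
    (LINT \<omega>|M. (dist_points (v \<bullet> W \<omega>) [a, b])\<^sup>2) - (LINT \<omega>|M. (v \<bullet> W \<omega>)\<^sup>2)
      + (LINT \<omega>|M. (norm (W \<omega>))\<^sup>2) + (norm p)\<^sup>2"
proof -
  interpret prob_space M by fact
  have [measurable]: "W \<in> borel_measurable M"
    using W(1) by simp
  have vW: "integrable M (\<lambda>\<omega>. (v \<bullet> W \<omega>)\<^sup>2)"
  proof (rule Bochner_Integration.integrable_bound [OF sq])
    have "(v \<bullet> W \<omega>)\<^sup>2 \<le> (norm (W \<omega>))\<^sup>2" for \<omega>
      using Cauchy_Schwarz_ineq2 [of v "W \<omega>"] v(1) by (simp add: abs_le_square_iff [symmetric])
    then show "AE \<omega> in M. norm ((v \<bullet> W \<omega>)\<^sup>2) \<le> norm ((norm (W \<omega>))\<^sup>2)"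
      by simp
  qed simp
  have D: "integrable M (\<lambda>\<omega>. (dist_points (v \<bullet> W \<omega>) [a, b])\<^sup>2)"
    by (rule integrable_dist_points_pair_sq) (use vW finite_measure_axioms in simp_all)
  have "integrable M (\<lambda>\<omega>. 2 * (p \<bullet> W \<omega>))" "(LINT \<omega>|M. 2 * (p \<bullet> W \<omega>)) = 0"
    using W by simp_all
  then show ?thesis
    using vW D sq unfolding dist_points_pair_sq_line [OF v] by (simp add: prob_space)
qed

text \<open>With \<open>D\<close> the optimal loss and \<open>E\<close> the second moment of
  \<open>Y\<close>, the loss of \<open>c * Y\<close> is at least \<open>c\<^sup>2 * D\<close>. The
  rest is \<open>(1 - c\<^sup>2) * (D - E) \<le> 0\<close>.\<close>

lemma principal_points_pair_contract:
  fixes Y :: "'w \<Rightarrow> real"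
  assumes pp: "principal_points M Y [g, h]" and c: "c\<^sup>2 \<le> 1"
  shows "(LINT \<omega>|M. (dist_points (Y \<omega>) [g, h])\<^sup>2) - (LINT \<omega>|M. (Y \<omega>)\<^sup>2)
    \<le> (LINT \<omega>|M. (dist_points (c * Y \<omega>) [a, b])\<^sup>2) - c\<^sup>2 * (LINT \<omega>|M. (Y \<omega>)\<^sup>2)"
proof -
  define D where "D = (LINT \<omega>|M. (dist_points (Y \<omega>) [g, h])\<^sup>2)"
  define E where "E = (LINT \<omega>|M. (Y \<omega>)\<^sup>2)"
  \<comment> \<open>The competitor is the point 0 taken twice, whose loss is the second
    moment.\<close>
  have "D \<le> (LINT \<omega>|M. (dist_points (Y \<omega>) [0, 0])\<^sup>2)"
    unfolding D_def by (rule principal_points_pair_le [OF pp])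
  then have "D \<le> E"
    by (simp add: dist_points_pair_sq_real E_def)
  have "c\<^sup>2 * D \<le> (LINT \<omega>|M. (dist_points (c * Y \<omega>) [a, b])\<^sup>2)"
  proof (cases "c = 0")
    case False
    then show ?thesis
      using principal_points_pair_le [OF pp, of "a / c" "b / c"]
      by (simp add: dist_points_pair_sq_scale D_def mult_left_mono)
  qed simp
  moreover have "(1 - c\<^sup>2) * D \<le> (1 - c\<^sup>2) * E"
    using \<open>D \<le> E\<close> c by (intro mult_left_mono) simp_all
  ultimately show ?thesis
    by (simp add: algebra_simps flip: D_def E_def)
qed

text \<open>The bound on the form by the largest eigenvalue makes the variance along
  \<open>v\<close> at most that along \<open>e\<close>, so the contraction lemma applies with
  \<open>c\<^sup>2\<close> their ratio.\<close>

lemma elliptical_loss_minus_variance_le: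
  fixes V :: "'w \<Rightarrow> 'h::{real_inner, banach, second_countable_topology}"
  assumes "prob_space M" and ell: "elliptical_with M V m G" and int: "integrable M V"
    and cov: "covariance_operator M V \<Gamma>" and eig: "largest_eigenvalue \<Gamma> l"
    and e: "\<Gamma> e = l *\<^sub>R e" "norm e = 1"
    and pp: "principal_points M (\<lambda>\<omega>. e \<bullet> (V \<omega> - m)) [g, h]"
    and v: "norm v = 1"
  shows "(LINT \<omega>|M. (dist_points (e \<bullet> (V \<omega> - m)) [g, h])\<^sup>2) - (LINT \<omega>|M. (e \<bullet> (V \<omega> - m))\<^sup>2)
    \<le> (LINT \<omega>|M. (dist_points (v \<bullet> (V \<omega> - m)) [a, b])\<^sup>2) - (LINT \<omega>|M. (v \<bullet> (V \<omega> - m))\<^sup>2)"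
proof -
  have mean: "(LINT \<omega>|M. V \<omega>) = m"
    by (rule elliptical_mean [OF assms(1) ell int])
  note form = covariance_operator_form [OF cov int, unfolded mean]
  have bG: "bounded_linear G" and compG: "compact_operator G"
    using ell by (auto simp: elliptical_with_def compact_operator_def)
  interpret G: bounded_linear G by fact
  obtain s where s: "\<Gamma> = (\<lambda>x. s *\<^sub>R G x)"
    using elliptical_covariance_operator [OF assms(1) ell int cov] .
  have le: "\<Gamma> v \<bullet> v \<le> l"
  proof (rule quadratic_form_le_largest_eigenvalue [OF _ _ _ eig v])
    show "compact_operator \<Gamma>"
      unfolding s by (rule compact_operator_scale [OF compG])
    show "self_adjoint \<Gamma>"
      by (rule covariance_operator_self_adjoint [OF cov])
    show "psd_operator \<Gamma>"
      by (simp add: psd_operator_def form)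
  qed
  have l: "\<Gamma> e \<bullet> e = l"
    using e by (simp add: norm_eq_1)
  have v0: "0 \<le> \<Gamma> v \<bullet> v"
    by (simp add: form)
  show ?thesis
  proof (cases "l = 0")
    \<comment> \<open>No ratio can be formed, but both variances are 0, and so is the optimal loss
      along \<open>e\<close>.\<close>
    case True
    have "(LINT \<omega>|M. (dist_points (e \<bullet> (V \<omega> - m)) [g, h])\<^sup>2)
        \<le> (LINT \<omega>|M. (dist_points (e \<bullet> (V \<omega> - m)) [0, 0])\<^sup>2)"
      by (rule principal_points_pair_le [OF pp])
    also have "\<dots> = 0"
      using True l by (simp add: dist_points_pair_sq_real form)
    also have "0 \<le> (LINT \<omega>|M. (dist_points (v \<bullet> (V \<omega> - m)) [a, b])\<^sup>2)"
      by simp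
    finally show ?thesis
      using True l v0 le by (simp add: form)
  next
    case False
    then have "0 < l"
      using le v0 by simp
    define c where "c = sqrt (\<Gamma> v \<bullet> v / l)"
    have c: "c\<^sup>2 = \<Gamma> v \<bullet> v / l"
      using v0 \<open>0 < l\<close> by (simp add: c_def)
    \<comment> \<open>Otherwise \<Gamma> and with it \<open>l\<close> would vanish. Cancelling
      \<open>s\<close> carries the ratio of variances over to the form of \<open>G\<close>, which
      governs the distributions.\<close>
    have "s \<noteq> 0"
      using False l s by auto
    have "s * (v \<bullet> G v) = c\<^sup>2 * (s * (e \<bullet> G e))"
      using l c False by (simp add: s inner_commute)
    then have "v \<bullet> G v = (c *\<^sub>R e) \<bullet> G (c *\<^sub>R e)"
      using \<open>s \<noteq> 0\<close> by (simp add: G.scaleR power2_eq_square)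
    moreover have "(\<lambda>x. (dist_points x [a, b])\<^sup>2) \<in> borel_measurable (borel :: real measure)"
      unfolding dist_points_pair_sq_real by measurable
    ultimately have "(LINT \<omega>|M. (dist_points (v \<bullet> (V \<omega> - m)) [a, b])\<^sup>2) =
        (LINT \<omega>|M. (dist_points ((c *\<^sub>R e) \<bullet> (V \<omega> - m)) [a, b])\<^sup>2)"
      by (rule elliptical_integral_eq [OF assms(1) ell])
    moreover have "c\<^sup>2 \<le> 1"
      using le \<open>0 < l\<close> by (simp add: c)
    moreover have "c\<^sup>2 * (LINT \<omega>|M. (e \<bullet> (V \<omega> - m))\<^sup>2) = (LINT \<omega>|M. (v \<bullet> (V \<omega> - m))\<^sup>2)"
      using c False l by (simp add: form)
    ultimately show ?thesis
      using principal_points_pair_contract [OF pp, of c a b] by simp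
  qed
qed

section \<open>Optimality among all pairs of points\<close>

theorem theorem3p5:
  fixes M :: "'w measure"
    and V :: "'w \<Rightarrow> 'h::{real_inner, banach, second_countable_topology}"
    and \<mu> \<phi>\<^sub>1 :: 'h
    and \<Gamma> :: "'h \<Rightarrow> 'h"
    and l\<^sub>1 \<gamma>\<^sub>1 \<gamma>\<^sub>2 :: real
  assumes "prob_space M"
    and "elliptical M V"
    and "integrable M V" and "\<mu> = (LINT \<omega>|M. V \<omega>)"
    and "covariance_operator M V \<Gamma>" and "finite_trace \<Gamma>"
    and "largest_eigenvalue \<Gamma> l\<^sub>1"
    and "\<Gamma> \<phi>\<^sub>1 = l\<^sub>1 *\<^sub>R \<phi>\<^sub>1" and "norm \<phi>\<^sub>1 = 1"
    and "\<And>v. \<exists>\<xi>\<^sub>1 \<xi>\<^sub>2. principal_points M (\<lambda>\<omega>. v \<bullet> (V \<omega> - \<mu>)) [\<xi>\<^sub>1, \<xi>\<^sub>2]"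
    and "principal_points M (\<lambda>\<omega>. \<phi>\<^sub>1 \<bullet> (V \<omega> - \<mu>)) [\<gamma>\<^sub>1, \<gamma>\<^sub>2]"
  shows "principal_points M V [\<mu> + \<gamma>\<^sub>1 *\<^sub>R \<phi>\<^sub>1, \<mu> + \<gamma>\<^sub>2 *\<^sub>R \<phi>\<^sub>1]"
proof -
  interpret prob_space M by fact
  obtain m G where ell: "elliptical_with M V m G"
    using assms(2) by (auto simp: elliptical_def)
  have m: "m = \<mu>"
    using elliptical_mean [OF assms(1) ell assms(3)] assms(4) by simp
  have V: "V \<in> borel_measurable M" "integrable M (\<lambda>\<omega>. (norm (V \<omega>))\<^sup>2)"
    using assms(5) by (simp_all add: covariance_operator_def)
  have W: "integrable M (\<lambda>\<omega>. V \<omega> - \<mu>)" "(LINT \<omega>|M. V \<omega> - \<mu>) = 0"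
    using assms(3,4) by (simp_all add: prob_space)
  have W2: "integrable M (\<lambda>\<omega>. (norm (V \<omega> - \<mu>))\<^sup>2)"
    using integrable_norm_diff_sq [OF finite_measure_axioms V] .
  note split = integral_dist_points_pair_line [OF assms(1) W W2]
  have shift: "dist_points z [y, y'] = dist_points (z - \<mu>) [y - \<mu>, y' - \<mu>]" for z y y'
    by (simp add: dist_points_def)
  have "(LINT \<omega>|M. (dist_points (V \<omega>) [\<mu> + \<gamma>\<^sub>1 *\<^sub>R \<phi>\<^sub>1, \<mu> + \<gamma>\<^sub>2 *\<^sub>R \<phi>\<^sub>1])\<^sup>2)
      \<le> (LINT \<omega>|M. (dist_points (V \<omega>) [y, y'])\<^sup>2)" for y y'
  proof -
    \<comment> \<open>\<open>\<phi>\<^sub>1\<close> only serves as the substitute direction in case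
      \<open>y = y'\<close>.\<close>
    obtain v p a b where v: "norm v = 1" "p \<bullet> v = 0"
      and y: "y - \<mu> = p + a *\<^sub>R v" "y' - \<mu> = p + b *\<^sub>R v"
      using exists_unit_line [OF assms(9), of "y - \<mu>" "y' - \<mu>"] .
    \<comment> \<open>The summand 0 presents the candidate points as a line with offset 0. After
      splitting, the expected squared norm is common to both sides, and the squared norm of
      \<open>p\<close> only enlarges the right one.\<close>
    have "(LINT \<omega>|M. (dist_points (V \<omega> - \<mu>) [0 + \<gamma>\<^sub>1 *\<^sub>R \<phi>\<^sub>1, 0 + \<gamma>\<^sub>2 *\<^sub>R \<phi>\<^sub>1])\<^sup>2)
      \<le> (LINT \<omega>|M. (dist_points (V \<omega> - \<mu>) [p + a *\<^sub>R v, p + b *\<^sub>R v])\<^sup>2)"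
      unfolding split [OF v] split [OF assms(9) inner_zero_left]
      using elliptical_loss_minus_variance_le [OF assms(1) ell assms(3,5,7,8,9) _ v(1),
          unfolded m, OF assms(11), of a b]
      by (intro add_mono) simp_all
    then show ?thesis
      unfolding shift [of _ y] shift [of _ "\<mu> + \<gamma>\<^sub>1 *\<^sub>R \<phi>\<^sub>1"] y by simp
  qed
  then have "(LINT \<omega>|M. (dist_points (V \<omega>) [\<mu> + \<gamma>\<^sub>1 *\<^sub>R \<phi>\<^sub>1, \<mu> + \<gamma>\<^sub>2 *\<^sub>R \<phi>\<^sub>1])\<^sup>2)
      \<le> (LINT \<omega>|M. (dist_points (V \<omega>) ys)\<^sup>2)" if "length ys = 2" for ys
    using that by (auto simp: numeral_2_eq_2 length_Suc_conv)
  then show ?thesis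
    using V by (simp add: principal_points_def)
qed

end
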